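(* Let $(X,\Sigma_X)$ be a measurable space, $p\ge 1$ an integer, $\mu$ a probability measure on $X$, and $Q,\overline{Q}:X\times\Sigma_X\to[0,1]$ Markov kernels. Define the Markov kernel $\mathcal{V}$ from $X$ to $X^p$ by $$\mathcal{V}(q_0,dq_1,\dots,dq_p)=\int_X\prod_{i=1}^p Q(q,dq_i)\,\overline{Q}(q_0,dq),$$ and let $\mathcal{M}$ be the probability measure on $X^{p+1}$ given by $\mathcal{M}(dq_0,dv)=\mathcal{V}(q_0,dv)\,\mu(dq_0)$, $v=(q_1,\dots,q_p)$. Let $S_0:=I$ and, for $j=1,\dots,p$, let $S_j:X^{p+1}\to X^{p+1}$ be the map exchanging the coordinates $0$ and $j$: $$S_j(q_0,q_1,\dots,q_p)=(q_j,q_1,\dots,q_{j-1},q_0,q_{j+1},\dots,q_p).$$ Then for every $j=0,1,\dots,p$, $$\sum_{k=0}^p (S_j\circ S_k)^*\mathcal{M}(E)=\sum_{k=0}^p S_k^*\mathcal{M}(E)\quad\text{for all measurable }E\subseteq X^{p+1}.$$ Therefore, if $\alpha_j:X\times X^p\to[0,1]$, $j=0,\dots,p$, are any measurable functions such that $\sum_{j=0}^p\int_{X^p}\alpha_j(q_0,v)\,\mathcal{V}(q_0,dv)=1$ for every $q_0\in X$ and $$\alpha_j(q_0,v)=\frac{dS_j^*\mathcal{M}}{d(S_0^*\mathcal{M}+\cdots+S_p^*\mathcal{M})}(q_0,v)\quad\text{for }\Big(\sum_{k=0}^pS_k^*\mathcal{M}\Big)\text{-a.e. }(q_0,v),$$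 then the Markov kernel $$P^{\alpha,S,\mathcal{V}}(q_0,d\tilde q)=\sum_{j=0}^p\int_{X^p}\alpha_j(q_0,v)\,\delta_{\Pi_1 S_j(q_0,v)}(d\tilde q)\,\mathcal{V}(q_0,dv)$$ satisfies detailed balance with respect to $\mu$, i.e. $P^{\alpha,S,\mathcal{V}}(q,d\tilde q)\,\mu(dq)=P^{\alpha,S,\mathcal{V}}(\tilde q,dq)\,\mu(d\tilde q)$ as measures on $X\times X$.
   Context: $X^p$ and $X^{p+1}$ carry the product $\sigma$-algebras. A Markov kernel $Q:X\times\Sigma_X\to[0,1]$ is a map such that $Q(q,\cdot)$ is a probability measure for each $q$ and $q\mapsto Q(q,E)$ is measurable for each $E\in\Sigma_X$. $\Pi_1(q_0,v)=q_0$ is the projection onto the first ($X$) component. $\phi^*\nu$ denotes the pushforward of the measure $\nu$ by $\phi$: $\phi^*\nu(E)=\nu(\phi^{-1}(E))$. $d\nu/d\rho$ denotes the Radon–Nikodym derivative. *)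

theory Defs
  imports "HOL-Probability.Probability"
begin

text \<open>
  A Markov kernel from \<open>X\<close> to \<open>Y\<close> is a measurable map from \<open>X\<close> to the Giry space of
  probability measures on \<open>Y\<close>; the following lemma recovers the usual two conditions.
\<close>

lemma markov_kernel_iff:
  "K \<in> X \<rightarrow>\<^sub>M prob_algebra Y \<longleftrightarrow>
    (\<forall>x\<in>space X. prob_space (K x) \<and> sets (K x) = sets Y) \<and>
    (\<forall>E\<in>sets Y. (\<lambda>x. emeasure (K x) E) \<in> borel_measurable X)"
proof
  assume K: "K \<in> X \<rightarrow>\<^sub>M prob_algebra Y"
  have "K x \<in> space (prob_algebra Y)" if "x \<in> space X" for x
    using measurable_space[OF K that] .
  moreover have "(\<lambda>x. emeasure (K x) E) \<in> borel_measurable X" if "E \<in> sets Y" for E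
    using measurable_emeasure_kernel[OF measurable_prob_algebraD[OF K] that] .
  ultimately show "(\<forall>x\<in>space X. prob_space (K x) \<and> sets (K x) = sets Y) \<and>
      (\<forall>E\<in>sets Y. (\<lambda>x. emeasure (K x) E) \<in> borel_measurable X)"
    by (auto simp: space_prob_algebra)
next
  assume *: "(\<forall>x\<in>space X. prob_space (K x) \<and> sets (K x) = sets Y) \<and>
      (\<forall>E\<in>sets Y. (\<lambda>x. emeasure (K x) E) \<in> borel_measurable X)"
  then have "K \<in> X \<rightarrow>\<^sub>M subprob_algebra Y"
    by (intro measurable_subprob_algebra) (auto intro: prob_space_imp_subprob_space)
  with * show "K \<in> X \<rightarrow>\<^sub>M prob_algebra Y"
    by (intro measurable_prob_algebraI) auto
qed

text \<open>
  \<open>X\<^sup>p\<close> has coordinates indexed by \<open>1, \<dots>, p\<close>, and \<open>X\<^sup>p\<^sup>+\<^sup>1\<close> is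
  \<open>X \<times> X\<^sup>p\<close>, a point \<open>(q\<^sub>0, v)\<close> having \<open>q\<^sub>0\<close> as coordinate \<open>0\<close> and \<open>v j\<close> as coordinate \<open>j \<ge> 1\<close>.
\<close>

definition power_space :: "'a measure \<Rightarrow> nat \<Rightarrow> (nat \<Rightarrow> 'a) measure" where
  "power_space X p = (\<Pi>\<^sub>M i\<in>{1..p}. X)"

definition full_space :: "'a measure \<Rightarrow> nat \<Rightarrow> ('a \<times> (nat \<Rightarrow> 'a)) measure" where
  "full_space X p = X \<Otimes>\<^sub>M power_space X p"

definition proposal_kernel ::
  "('a \<Rightarrow> 'a measure) \<Rightarrow> ('a \<Rightarrow> 'a measure) \<Rightarrow> nat \<Rightarrow> 'a \<Rightarrow> (nat \<Rightarrow> 'a) measure" where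
  "proposal_kernel Q Qbar p q0 = Qbar q0 \<bind> (\<lambda>q. \<Pi>\<^sub>M i\<in>{1..p}. Q q)"

text \<open>The measure \<open>K(x, dy) \<mu>(dx)\<close> on the product of \<open>X\<close> and \<open>Y\<close>.\<close>

definition joint_measure ::
  "'a measure \<Rightarrow> 'b measure \<Rightarrow> 'a measure \<Rightarrow> ('a \<Rightarrow> 'b measure) \<Rightarrow> ('a \<times> 'b) measure" where
  "joint_measure X Y \<mu> K = do { x \<leftarrow> \<mu>; y \<leftarrow> K x; return (X \<Otimes>\<^sub>M Y) (x, y) }"

definition swap_coord :: "nat \<Rightarrow> 'a \<times> (nat \<Rightarrow> 'a) \<Rightarrow> 'a \<times> (nat \<Rightarrow> 'a)" where
  "swap_coord j = (\<lambda>(q0, v). if j = 0 then (q0, v) else (v j, v(j := q0)))"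

definition sum_measure :: "'a measure \<Rightarrow> 'i set \<Rightarrow> ('i \<Rightarrow> 'a measure) \<Rightarrow> 'a measure" where
  "sum_measure N I \<nu> = measure_of (space N) (sets N) (\<lambda>E. \<Sum>i\<in>I. emeasure (\<nu> i) E)"

lemma sets_sum_measure [simp, measurable_cong]: "sets (sum_measure N I \<nu>) = sets N"
  by (simp add: sum_measure_def)

lemma space_sum_measure [simp]: "space (sum_measure N I \<nu>) = space N"
  by (simp add: sum_measure_def)

lemma emeasure_sum_measure:
  assumes "\<And>i. i \<in> I \<Longrightarrow> sets (\<nu> i) = sets N" and "E \<in> sets N"
  shows "emeasure (sum_measure N I \<nu>) E = (\<Sum>i\<in>I. emeasure (\<nu> i) E)"
proof (rule emeasure_measure_of[OF sum_measure_def])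
  show "countably_additive (sets (sum_measure N I \<nu>)) (\<lambda>E. \<Sum>i\<in>I. emeasure (\<nu> i) E)"
  proof (rule countably_additiveI)
    fix A :: "nat \<Rightarrow> _"
    assume A: "range A \<subseteq> sets (sum_measure N I \<nu>)" "disjoint_family A"
    have "(\<Sum>n. \<Sum>i\<in>I. emeasure (\<nu> i) (A n)) = (\<Sum>i\<in>I. \<Sum>n. emeasure (\<nu> i) (A n))"
      by (intro suminf_sum) auto
    also have "\<dots> = (\<Sum>i\<in>I. emeasure (\<nu> i) (\<Union>n. A n))"
      using A assms(1) by (intro sum.cong suminf_emeasure) auto
    finally show "(\<Sum>n. \<Sum>i\<in>I. emeasure (\<nu> i) (A n)) = (\<Sum>i\<in>I. emeasure (\<nu> i) (\<Union>n. A n))" .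
  qed
qed (use assms in \<open>auto simp: positive_def dest: sets.sets_into_space\<close>)

definition multiproposal_kernel ::
  "'a measure \<Rightarrow> nat \<Rightarrow> (nat \<Rightarrow> 'a \<times> (nat \<Rightarrow> 'a) \<Rightarrow> real) \<Rightarrow>
    (nat \<Rightarrow> 'a \<times> (nat \<Rightarrow> 'a) \<Rightarrow> 'a \<times> (nat \<Rightarrow> 'a)) \<Rightarrow> ('a \<Rightarrow> (nat \<Rightarrow> 'a) measure) \<Rightarrow>
    'a \<Rightarrow> 'a measure" where
  "multiproposal_kernel X p \<alpha> S V q0 =
    measure_of (space X) (sets X)
      (\<lambda>A. \<Sum>j\<le>p. \<integral>\<^sup>+v. ennreal (\<alpha> j (q0, v)) * emeasure (return X (fst (S j (q0, v)))) A \<partial>V q0)"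

definition detailed_balance :: "'a measure \<Rightarrow> 'a measure \<Rightarrow> ('a \<Rightarrow> 'a measure) \<Rightarrow> bool" where
  "detailed_balance X \<mu> P \<longleftrightarrow>
    do { q \<leftarrow> \<mu>; q' \<leftarrow> P q; return (X \<Otimes>\<^sub>M X) (q, q') } =
    do { q' \<leftarrow> \<mu>; q \<leftarrow> P q'; return (X \<Otimes>\<^sub>M X) (q, q') }"

end

theory Submission
  imports Defs
begin

text \<open>
  Given \<open>q\<^sub>0\<close>, the proposals \<open>q\<^sub>1, \<dots>, q\<^sub>p\<close> are exchangeable, so \<open>\<M>\<close> is invariant under permutations of
  the coordinates \<open>1, \<dots>, p\<close>. For distinct \<open>j, k \<ge> 1\<close> one has \<open>S\<^sub>j \<circ> S\<^sub>k = S\<^sub>k \<circ> T\<close> with \<open>T\<close> the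
  transposition of the coordinates \<open>j\<close> and \<open>k\<close>, and \<open>S\<^sub>j \<circ> S\<^sub>j = I\<close>; hence composing with \<open>S\<^sub>j\<close> merely
  permutes the pushforwards \<open>S\<^sub>k\<^sup>*\<M>\<close>, and their sum \<open>N\<close> is \<open>S\<^sub>j\<close>-invariant.

  The \<open>\<alpha>\<^sub>j\<close> are the densities of \<open>S\<^sub>j\<^sup>*\<M>\<close> with respect to \<open>N\<close>; in particular \<open>\<M> = \<alpha>\<^sub>0 N\<close>. Therefore
  \<open>\<integral> \<alpha>\<^sub>j g d\<M> = \<integral> \<alpha>\<^sub>0 \<alpha>\<^sub>j g dN = \<integral> (\<alpha>\<^sub>0 g) \<circ> S\<^sub>j d\<M> = \<integral> \<alpha>\<^sub>0 (\<alpha>\<^sub>0 \<circ> S\<^sub>j) (g \<circ> S\<^sub>j) dN\<close>, and the invariance of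
  \<open>N\<close> under the involution \<open>S\<^sub>j\<close> allows one to replace \<open>g\<close> by \<open>g \<circ> S\<^sub>j\<close>. Applied to
  \<open>g = 1\<^sub>E(\<Pi>\<^sub>1 z, \<Pi>\<^sub>1 S\<^sub>j z)\<close> and summed over \<open>j\<close>, this is detailed balance.
\<close>

section \<open>Exchangeability of the proposals\<close>

text \<open>Measurability into the Giry space may be tested on an intersection-stable generator. For
  finite \<open>I\<close> the generator consists of boxes, and the mass of a box is a finite product
  of functions measurable in \<open>x\<close>.\<close>

lemma measurable_PiM_kernel:
  assumes K: "K \<in> X \<rightarrow>\<^sub>M prob_algebra Y" and I: "finite I"
  shows "(\<lambda>x. \<Pi>\<^sub>M i\<in>I. K x) \<in> X \<rightarrow>\<^sub>M prob_algebra (\<Pi>\<^sub>M i\<in>I. Y)"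
proof (rule measurable_prob_algebra_generated[OF sets_PiM Int_stable_prod_algebra prod_algebra_sets_into_space])
  have prob: "prob_space (K x)" and sets: "sets (K x) = sets Y" if "x \<in> space X" for x
    using K that by (auto simp: markov_kernel_iff)
  show "prob_space (\<Pi>\<^sub>M i\<in>I. K x)" if "x \<in> space X" for x
    using prob[OF that] by (intro prob_space_PiM)
  show "sets (\<Pi>\<^sub>M i\<in>I. K x) = sets (\<Pi>\<^sub>M i\<in>I. Y)" if "x \<in> space X" for x
    using sets[OF that] by (intro sets_PiM_cong) auto
  fix A assume "A \<in> prod_algebra I (\<lambda>i. Y)"
  then obtain E where A: "A = Pi\<^sub>E I E" and E: "\<And>i. i \<in> I \<Longrightarrow> E i \<in> sets Y"
    using I by (auto simp: prod_algebra_eq_finite)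
  have "emeasure (\<Pi>\<^sub>M i\<in>I. K x) A = (\<Prod>i\<in>I. emeasure (K x) (E i))" if x: "x \<in> space X" for x
  proof -
    interpret prob_space "K x" by (rule prob[OF x])
    interpret product_sigma_finite "\<lambda>i. K x" by standard
    show ?thesis unfolding A using E sets[OF x] by (intro emeasure_PiM I) auto
  qed
  moreover have "(\<lambda>x. \<Prod>i\<in>I. emeasure (K x) (E i)) \<in> borel_measurable X"
    using K E by (intro borel_measurable_prod_ennreal) (auto simp: markov_kernel_iff)
  ultimately show "(\<lambda>x. emeasure (\<Pi>\<^sub>M i\<in>I. K x) A) \<in> borel_measurable X"
    by (simp cong: measurable_cong)
qed

lemma measurable_proposal_kernel:
  assumes "Q \<in> X \<rightarrow>\<^sub>M prob_algebra X" "Qbar \<in> X \<rightarrow>\<^sub>M prob_algebra X"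
  shows "proposal_kernel Q Qbar p \<in> X \<rightarrow>\<^sub>M prob_algebra (power_space X p)"
  unfolding proposal_kernel_def power_space_def
  using assms by (intro measurable_bind_prob_space measurable_PiM_kernel) auto

text \<open>The restriction makes the result extensional, as points of \<open>power_space\<close>
  must be.\<close>

definition permute_coords :: "nat \<Rightarrow> (nat \<Rightarrow> nat) \<Rightarrow> (nat \<Rightarrow> 'a) \<Rightarrow> nat \<Rightarrow> 'a" where
  "permute_coords p \<pi> v = (\<lambda>i\<in>{1..p}. v (\<pi> i))"

lemma measurable_permute_coords:
  assumes "\<pi> permutes {1..p}"
  shows "permute_coords p \<pi> \<in> power_space X p \<rightarrow>\<^sub>M power_space X p"
  unfolding permute_coords_def power_space_def
  using permutes_in_image[OF assms]
  by (intro measurable_restrict measurable_component_singleton) blast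

text \<open>For fixed \<open>q\<close> the coordinates are i.i.d. with law \<open>Q q\<close>, so an
  injective reindexing leaves the product measure unchanged. Pushforward commutes with
  \<open>\<bind>\<close>, hence mixing over \<open>q\<close> keeps the invariance.\<close>

lemma distr_proposal_kernel_permute:
  assumes Q: "Q \<in> X \<rightarrow>\<^sub>M prob_algebra X" and Qbar: "Qbar \<in> X \<rightarrow>\<^sub>M prob_algebra X"
    and q0: "q0 \<in> space X" and \<pi>: "\<pi> permutes {1..p}"
  shows "distr (proposal_kernel Q Qbar p q0) (power_space X p) (permute_coords p \<pi>) =
    proposal_kernel Q Qbar p q0"
proof -
  have Qbar0: "prob_space (Qbar q0)" "sets (Qbar q0) = sets X"
    using Qbar q0 by (auto simp: markov_kernel_iff)
  have K: "(\<lambda>q. \<Pi>\<^sub>M i\<in>{1..p}. Q q) \<in> Qbar q0 \<rightarrow>\<^sub>M subprob_algebra (power_space X p)"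
    unfolding power_space_def measurable_cong_sets[OF Qbar0(2) refl]
    by (intro measurable_prob_algebraD measurable_PiM_kernel Q) simp
  have "distr (\<Pi>\<^sub>M i\<in>{1..p}. Q q) (power_space X p) (permute_coords p \<pi>) = (\<Pi>\<^sub>M i\<in>{1..p}. Q q)"
    if "q \<in> space (Qbar q0)" for q
  proof -
    have q: "prob_space (Q q)" "sets (Q q) = sets X"
      using Q that sets_eq_imp_space_eq[OF Qbar0(2)] by (auto simp: markov_kernel_iff)
    have "distr (\<Pi>\<^sub>M i\<in>{1..p}. Q q) (power_space X p) (permute_coords p \<pi>) =
        distr (\<Pi>\<^sub>M i\<in>{1..p}. Q q) (\<Pi>\<^sub>M i\<in>{1..p}. Q q) (\<lambda>v. \<lambda>i\<in>{1..p}. v (\<pi> i))"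
      unfolding power_space_def permute_coords_def
      using q by (intro distr_cong sets_PiM_cong) auto
    also have "\<dots> = (\<Pi>\<^sub>M i\<in>{1..p}. Q q)"
      using q permutes_inj_on[OF \<pi>] permutes_in_image[OF \<pi>]
      by (intro distr_PiM_reindex[where M = "\<lambda>i. Q q"]) auto
    finally show ?thesis .
  qed
  then show ?thesis
    unfolding proposal_kernel_def
    by (subst distr_bind[OF K prob_space.not_empty[OF Qbar0(1)] measurable_permute_coords[OF \<pi>]])
       (intro bind_cong refl)
qed

section \<open>Integration against composed kernels and joint measures\<close>

text \<open>The general \<open>g\<close> serves three measures: \<open>g = Pair\<close> covers
  \<open>joint_measure\<close> and the left side of detailed balance, the flipped pair covers the
  right side.\<close>

lemma
  assumes \<mu>: "prob_space \<mu>" "sets \<mu> = sets X" and K: "K \<in> X \<rightarrow>\<^sub>M prob_algebra Y"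
    and g[measurable]: "case_prod g \<in> X \<Otimes>\<^sub>M Y \<rightarrow>\<^sub>M Z"
  defines "B \<equiv> \<mu> \<bind> (\<lambda>x. K x \<bind> (\<lambda>y. return Z (g x y)))"
  shows bind_return_in_prob_algebra: "B \<in> space (prob_algebra Z)"
    and nn_integral_bind_return: "f \<in> borel_measurable Z \<Longrightarrow>
      (\<integral>\<^sup>+z. f z \<partial>B) = (\<integral>\<^sup>+x. \<integral>\<^sup>+y. f (g x y) \<partial>K x \<partial>\<mu>)"
proof -
  note [measurable] = K
  have \<mu>': "\<mu> \<in> space (prob_algebra X)"
    using \<mu> by (simp add: space_prob_algebra)
  have inner: "(\<lambda>x. K x \<bind> (\<lambda>y. return Z (g x y))) \<in> X \<rightarrow>\<^sub>M prob_algebra Z"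
    by measurable
  \<comment> \<open>The composition rule speaks of kernels, so \<open>\<mu>\<close> enters as a
    constant kernel on the one-point space.\<close>
  show "B \<in> space (prob_algebra Z)"
    unfolding B_def using measurable_bind_prob_space[OF measurable_const[OF \<mu>'] inner, of "count_space {()}"]
    by (auto dest: measurable_space)
  assume f[measurable]: "f \<in> borel_measurable Z"
  have "(\<integral>\<^sup>+z. f z \<partial>B) = (\<integral>\<^sup>+x. \<integral>\<^sup>+z. f z \<partial>(K x \<bind> (\<lambda>y. return Z (g x y))) \<partial>\<mu>)"
    unfolding B_def using measurable_prob_algebraD[OF inner]
    by (intro nn_integral_bind[OF f]) (simp add: measurable_cong_sets[OF \<mu>(2) refl])
  also have "\<dots> = (\<integral>\<^sup>+x. \<integral>\<^sup>+y. f (g x y) \<partial>K x \<partial>\<mu>)"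
  proof (intro nn_integral_cong)
    fix x assume "x \<in> space \<mu>"
    then have x[measurable]: "x \<in> space X"
      using sets_eq_imp_space_eq[OF \<mu>(2)] by simp
    have Kx[measurable_cong]: "sets (K x) = sets Y"
      using K x by (auto simp: markov_kernel_iff)
    have gx[measurable]: "g x \<in> Y \<rightarrow>\<^sub>M Z"
      using measurable_Pair2[OF g x] by simp
    have "(\<integral>\<^sup>+z. f z \<partial>(K x \<bind> (\<lambda>y. return Z (g x y)))) =
        (\<integral>\<^sup>+y. \<integral>\<^sup>+z. f z \<partial>return Z (g x y) \<partial>K x)"
      by (intro nn_integral_bind[OF f]) measurable
    also have "\<dots> = (\<integral>\<^sup>+y. f (g x y) \<partial>K x)"
      using sets_eq_imp_space_eq[OF Kx] measurable_space[OF gx]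
      by (intro nn_integral_cong nn_integral_return) auto
    finally show "(\<integral>\<^sup>+z. f z \<partial>(K x \<bind> (\<lambda>y. return Z (g x y)))) = (\<integral>\<^sup>+y. f (g x y) \<partial>K x)" .
  qed
  finally show "(\<integral>\<^sup>+z. f z \<partial>B) = (\<integral>\<^sup>+x. \<integral>\<^sup>+y. f (g x y) \<partial>K x \<partial>\<mu>)" .
qed

lemma
  assumes \<mu>: "prob_space \<mu>" "sets \<mu> = sets X" and K: "K \<in> X \<rightarrow>\<^sub>M prob_algebra Y"
  shows joint_measure_in_prob_algebra: "joint_measure X Y \<mu> K \<in> space (prob_algebra (X \<Otimes>\<^sub>M Y))"
    and nn_integral_joint_measure: "f \<in> borel_measurable (X \<Otimes>\<^sub>M Y) \<Longrightarrow>
      (\<integral>\<^sup>+z. f z \<partial>joint_measure X Y \<mu> K) = (\<integral>\<^sup>+x. \<integral>\<^sup>+y. f (x, y) \<partial>K x \<partial>\<mu>)"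
  unfolding joint_measure_def
  using bind_return_in_prob_algebra[OF \<mu> K, of Pair] nn_integral_bind_return[OF \<mu> K, of Pair] by auto

text \<open>\<open>t\<close> acts within each fibre and preserves its conditional law, so
  integrating an indicator first over the fibre and then over the base does not see it.\<close>

lemma distr_joint_measure_map_snd:
  assumes \<mu>: "prob_space \<mu>" "sets \<mu> = sets X" and K: "K \<in> X \<rightarrow>\<^sub>M prob_algebra Y"
    and t[measurable]: "t \<in> Y \<rightarrow>\<^sub>M Y" and inv: "\<And>x. x \<in> space X \<Longrightarrow> distr (K x) Y t = K x"
  shows "distr (joint_measure X Y \<mu> K) (X \<Otimes>\<^sub>M Y) (\<lambda>(x, y). (x, t y)) = joint_measure X Y \<mu> K"
    (is "distr ?M ?N ?T = _")
proof (rule measure_eqI)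
  have M[measurable_cong]: "sets ?M = sets ?N"
    using joint_measure_in_prob_algebra[OF \<mu> K] by (simp add: space_prob_algebra)
  show "sets (distr ?M ?N ?T) = sets ?M" by (simp add: M)
  fix E assume "E \<in> sets (distr ?M ?N ?T)"
  then have E[measurable]: "E \<in> sets ?N" by simp
  have "emeasure (distr ?M ?N ?T) E = (\<integral>\<^sup>+z. indicator E z \<partial>distr ?M ?N ?T)"
    by simp
  also have "\<dots> = (\<integral>\<^sup>+z. indicator E (?T z) \<partial>?M)"
    by (intro nn_integral_distr) measurable
  also have "\<dots> = (\<integral>\<^sup>+x. \<integral>\<^sup>+y. indicator E (x, t y) \<partial>K x \<partial>\<mu>)"
    by (subst nn_integral_joint_measure[OF \<mu> K]) simp_all
  also have "\<dots> = (\<integral>\<^sup>+x. \<integral>\<^sup>+y. indicator E (x, y) \<partial>K x \<partial>\<mu>)"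
  proof (rule nn_integral_cong)
    fix x assume "x \<in> space \<mu>"
    then have x[measurable]: "x \<in> space X"
      using sets_eq_imp_space_eq[OF \<mu>(2)] by simp
    have [measurable_cong]: "sets (K x) = sets Y"
      using K x by (auto simp: markov_kernel_iff)
    have "(\<integral>\<^sup>+y. indicator E (x, y) \<partial>K x) = (\<integral>\<^sup>+y. indicator E (x, y) \<partial>distr (K x) Y t)"
      by (simp only: inv[OF x])
    also have "\<dots> = (\<integral>\<^sup>+y. indicator E (x, t y) \<partial>K x)"
      by (intro nn_integral_distr) measurable
    finally show "(\<integral>\<^sup>+y. indicator E (x, t y) \<partial>K x) = (\<integral>\<^sup>+y. indicator E (x, y) \<partial>K x)" ..
  qed
  also have "\<dots> = (\<integral>\<^sup>+z. indicator E z \<partial>?M)"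
    by (subst nn_integral_joint_measure[OF \<mu> K]) simp_all
  finally show "emeasure (distr ?M ?N ?T) E = emeasure ?M E"
    using M by simp
qed

section \<open>Coordinate swaps acting on the joint law\<close>

lemma swap_coord_0: "swap_coord 0 z = z"
  by (simp add: swap_coord_def split: prod.split)

lemma swap_coord_involution: "swap_coord j (swap_coord j z) = z"
  by (simp add: swap_coord_def split: prod.split)

lemma measurable_swap_coord:
  assumes "j \<le> p"
  shows "swap_coord j \<in> full_space X p \<rightarrow>\<^sub>M full_space X p"
proof (cases "j = 0")
  case True
  then have "swap_coord j = (\<lambda>z :: 'a \<times> (nat \<Rightarrow> 'a). z)"
    by (auto simp: swap_coord_0)
  then show ?thesis by simp
next
  case False
  with assms have j: "j \<in> {1..p}" by auto
  \<comment> \<open>The update rule adds \<open>j\<close> to the index set; as \<open>j\<close> is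
    already an index, the set remains \<open>{1..p}\<close>.\<close>
  have *: "insert j {1..p} = {1..p}" using j by auto
  have "(\<lambda>(q0, v). v(j := q0)) \<in> full_space X p \<rightarrow>\<^sub>M power_space X p"
    unfolding full_space_def power_space_def split_beta'
    using measurable_fun_upd[of "{1..p}" "{1..p}" j snd "X \<Otimes>\<^sub>M (\<Pi>\<^sub>M i\<in>{1..p}. X)" "\<lambda>_. X" fst] * by simp
  moreover have "(\<lambda>(q0, v). v j) \<in> full_space X p \<rightarrow>\<^sub>M X"
    unfolding full_space_def power_space_def split_beta' using j by measurable
  ultimately have "(\<lambda>z. (case z of (q0, v) \<Rightarrow> v j, case z of (q0, v) \<Rightarrow> v(j := q0)))
      \<in> full_space X p \<rightarrow>\<^sub>M X \<Otimes>\<^sub>M power_space X p"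
    by (rule measurable_Pair[rotated])
  also have "(\<lambda>z. (case z of (q0, v) \<Rightarrow> v j, case z of (q0, v) \<Rightarrow> v(j := q0))) = swap_coord j"
    using False by (auto simp: swap_coord_def)
  finally show ?thesis by (simp add: full_space_def)
qed

text \<open>This is conjugation of transpositions: moved past the swap of 0 and \<open>k\<close>,
  the swap of 0 and \<open>j\<close> becomes that of \<open>j\<close> and \<open>k\<close>. Off
  \<open>{1..p}\<close> the left side keeps the values of \<open>v\<close> while the right side is
  \<open>undefined\<close>; extensionality reconciles them.\<close>

lemma swap_coord_conj:
  assumes "j \<in> {1..p}" "k \<in> {1..p}" "j \<noteq> k" "v \<in> extensional {1..p}"
  shows "swap_coord j (swap_coord k (q0, v)) =
    swap_coord k (q0, permute_coords p (Transposition.transpose j k) v)"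
  using assms
  by (auto simp: swap_coord_def permute_coords_def fun_eq_iff Transposition.transpose_def extensional_def)

text \<open>After the conjugation, \<open>swap_coord k\<close> is preceded by a transposition of the
  proposals, which preserves \<open>M\<close> because it preserves every fibre law.\<close>

lemma distr_swap_coord_swap_coord:
  assumes \<mu>: "prob_space \<mu>" "sets \<mu> = sets X"
    and Q: "Q \<in> X \<rightarrow>\<^sub>M prob_algebra X" and Qbar: "Qbar \<in> X \<rightarrow>\<^sub>M prob_algebra X"
    and j: "j \<in> {1..p}" and k: "k \<in> {1..p}" and jk: "j \<noteq> k"
  defines "M \<equiv> joint_measure X (power_space X p) \<mu> (proposal_kernel Q Qbar p)"
  shows "distr M (full_space X p) (swap_coord j \<circ> swap_coord k) = distr M (full_space X p) (swap_coord k)"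
proof -
  let ?V = "proposal_kernel Q Qbar p" and ?t = "permute_coords p (Transposition.transpose j k)"
  let ?T = "\<lambda>(q0, v). (q0, ?t v)"
  have V: "?V \<in> X \<rightarrow>\<^sub>M prob_algebra (power_space X p)"
    using Q Qbar by (rule measurable_proposal_kernel)
  have perm: "Transposition.transpose j k permutes {1..p}"
    using j k by (rule permutes_swap_id)
  note t[measurable] = measurable_permute_coords[OF perm, of X]
  have M[measurable_cong]: "sets M = sets (X \<Otimes>\<^sub>M power_space X p)"
    using joint_measure_in_prob_algebra[OF \<mu> V] by (simp add: M_def space_prob_algebra)
  have S: "swap_coord k \<in> X \<Otimes>\<^sub>M power_space X p \<rightarrow>\<^sub>M full_space X p"
    using measurable_swap_coord[of k p X] k by (simp add: full_space_def)
  have "distr M (full_space X p) (swap_coord j \<circ> swap_coord k) =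
      distr M (full_space X p) (swap_coord k \<circ> ?T)"
  proof (intro distr_cong refl)
    \<comment> \<open>The maps need to agree only on \<open>space M\<close>, where the second
      component is extensional.\<close>
    fix z assume "z \<in> space M"
    then obtain q0 v where "z = (q0, v)" "v \<in> extensional {1..p}"
      by (auto simp: sets_eq_imp_space_eq[OF M] space_pair_measure power_space_def space_PiM PiE_def)
    then show "(swap_coord j \<circ> swap_coord k) z = (swap_coord k \<circ> ?T) z"
      using swap_coord_conj[OF j k jk] by simp
  qed
  also have "\<dots> = distr (distr M (X \<Otimes>\<^sub>M power_space X p) ?T) (full_space X p) (swap_coord k)"
    by (intro distr_distr[symmetric] S) measurable
  also have "distr M (X \<Otimes>\<^sub>M power_space X p) ?T = M"
    unfolding M_def using distr_proposal_kernel_permute[OF Q Qbar _ perm]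
    by (intro distr_joint_measure_map_snd \<mu> V t)
  finally show ?thesis .
qed

text \<open>Composition with \<open>swap_coord j\<close> permutes the summands by the transposition
  of 0 and \<open>j\<close>: these two indices change places, and every other index is fixed by
  exchangeability.\<close>

lemma sum_pushforward_swap_coord:
  assumes \<mu>: "prob_space \<mu>" "sets \<mu> = sets X"
    and Q: "Q \<in> X \<rightarrow>\<^sub>M prob_algebra X" and Qbar: "Qbar \<in> X \<rightarrow>\<^sub>M prob_algebra X" and j: "j \<le> p"
  defines "M \<equiv> joint_measure X (power_space X p) \<mu> (proposal_kernel Q Qbar p)"
  shows "(\<Sum>k\<le>p. emeasure (distr M (full_space X p) (swap_coord j \<circ> swap_coord k)) E) =
    (\<Sum>k\<le>p. emeasure (distr M (full_space X p) (swap_coord k)) E)"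
proof (rule sum.reindex_bij_witness[where i = "Transposition.transpose 0 j" and j = "Transposition.transpose 0 j"])
  fix k assume "k \<in> {..p}"
  \<comment> \<open>The first three cases are identities of maps, since \<open>swap_coord 0\<close>
    is the identity and swaps are involutions; only the last uses the law \<open>M\<close>.\<close>
  then consider "j = 0" | "k = 0" | "j = k" | "j \<in> {1..p}" "k \<in> {1..p}" "j \<noteq> k" using j by fastforce
  then have "distr M (full_space X p) (swap_coord (Transposition.transpose 0 j k)) =
      distr M (full_space X p) (swap_coord j \<circ> swap_coord k)"
  proof cases
    case 4
    then have "Transposition.transpose 0 j k = k" by (auto simp: Transposition.transpose_def)
    then show ?thesis
      using distr_swap_coord_swap_coord[OF \<mu> Q Qbar 4] by (simp add: M_def)
  qed (simp_all add: comp_def swap_coord_0[abs_def] swap_coord_involution)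
  then show "emeasure (distr M (full_space X p) (swap_coord (Transposition.transpose 0 j k))) E =
      emeasure (distr M (full_space X p) (swap_coord j \<circ> swap_coord k)) E"
    by simp
qed (use j in \<open>auto simp: Transposition.transpose_def\<close>)

section \<open>Reversibility from densities and an invariant reference measure\<close>

text \<open>The measure \<open>b dM\<close> has density \<open>a z * a (S z)\<close> with respect to
  \<open>N\<close>. This is symmetric under the involution \<open>S\<close>, which also preserves
  \<open>N\<close>, so \<open>b dM\<close> is \<open>S\<close>-invariant. In the application
  \<open>a\<close> is \<alpha> with index 0 and \<open>b\<close> is \<alpha> with index
  \<open>j\<close>.\<close>

lemma nn_integral_density_involution:
  fixes a b :: "'a \<Rightarrow> ennreal"
  assumes S[measurable]: "S \<in> N \<rightarrow>\<^sub>M N" and SS: "\<And>z. z \<in> space N \<Longrightarrow> S (S z) = z"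
    and inv: "distr N N S = N"
    and [measurable]: "a \<in> borel_measurable N" "b \<in> borel_measurable N" "g \<in> borel_measurable N"
    and Ma: "density N a = M" and Mb: "density N b = distr M N S"
  shows "(\<integral>\<^sup>+z. b z * g z \<partial>M) = (\<integral>\<^sup>+z. b z * g (S z) \<partial>M)"
proof -
  have *: "(\<integral>\<^sup>+z. b z * h z \<partial>M) = (\<integral>\<^sup>+z. a z * a (S z) * h (S z) \<partial>N)"
    if [measurable]: "h \<in> borel_measurable N" for h
  proof -
    have "(\<integral>\<^sup>+z. b z * h z \<partial>M) = (\<integral>\<^sup>+z. a z * (b z * h z) \<partial>N)"
      unfolding Ma[symmetric] by (intro nn_integral_density) measurable
    also have "\<dots> = (\<integral>\<^sup>+z. b z * (a z * h z) \<partial>N)"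
      by (simp add: mult_ac)
    \<comment> \<open>Here \<open>b\<close> is absorbed together with \<open>N\<close> into the
      pushforward of \<open>M\<close>, so that \<open>S\<close> moves the remaining factor
      \<open>a\<close>.\<close>
    also have "\<dots> = (\<integral>\<^sup>+z. a z * h z \<partial>distr M N S)"
      unfolding Mb[symmetric] by (intro nn_integral_density[symmetric]) measurable
    also have "\<dots> = (\<integral>\<^sup>+z. a (S z) * h (S z) \<partial>M)"
      by (intro nn_integral_distr) (simp_all add: Ma[symmetric])
    also have "\<dots> = (\<integral>\<^sup>+z. a z * (a (S z) * h (S z)) \<partial>N)"
      unfolding Ma[symmetric] by (intro nn_integral_density) measurable
    finally show ?thesis by (simp add: mult_ac)
  qed
  have "(\<integral>\<^sup>+z. b z * g z \<partial>M) = (\<integral>\<^sup>+z. a z * a (S z) * g (S z) \<partial>N)"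
    by (rule *) measurable
  \<comment> \<open>Change of variables by invariance of \<open>N\<close>; writing
    \<open>g z\<close> as \<open>g (S (S z))\<close> then prepares the second use of
    \<open>*\<close>, with \<open>h = g \<circ> S\<close>.\<close>
  also have "\<dots> = (\<integral>\<^sup>+z. a (S z) * a z * g z \<partial>distr N N S)"
    by (subst nn_integral_distr) (simp_all add: SS mult_ac cong: nn_integral_cong)
  also have "\<dots> = (\<integral>\<^sup>+z. a z * a (S z) * g (S (S z)) \<partial>N)"
    unfolding inv by (intro nn_integral_cong) (simp add: SS mult_ac)
  also have "\<dots> = (\<integral>\<^sup>+z. b z * g (S z) \<partial>M)"
    by (rule *[symmetric]) measurable
  finally show ?thesis .
qed

section \<open>The multiproposal kernel is a Markov kernel\<close>

lemma sets_multiproposal_kernel: "sets (multiproposal_kernel X p \<alpha> S V q0) = sets X"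
  by (simp add: multiproposal_kernel_def)

text \<open>A measure built by \<open>measure_of\<close> has the prescribed values only if the set
  function is countably additive. This holds because it is a finite sum of measures
  \<open>D j\<close>: weight \<open>V q0\<close> by \<open>\<alpha> j\<close>, then push forward to
  the first coordinate after \<open>S j\<close>.\<close>

lemma
  fixes \<alpha> :: "nat \<Rightarrow> 'a \<times> (nat \<Rightarrow> 'a) \<Rightarrow> real"
  assumes V: "V \<in> X \<rightarrow>\<^sub>M prob_algebra (power_space X p)"
    and \<alpha>: "\<And>j. j \<le> p \<Longrightarrow> \<alpha> j \<in> borel_measurable (full_space X p)"
    and S: "\<And>j. j \<le> p \<Longrightarrow> S j \<in> full_space X p \<rightarrow>\<^sub>M full_space X p"
  shows emeasure_multiproposal_kernel: "q0 \<in> space X \<Longrightarrow> A \<in> sets X \<Longrightarrow>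
      emeasure (multiproposal_kernel X p \<alpha> S V q0) A =
        (\<Sum>j\<le>p. \<integral>\<^sup>+v. ennreal (\<alpha> j (q0, v)) * indicator A (fst (S j (q0, v))) \<partial>V q0)"
    and measurable_multiproposal_kernel:
      "(\<And>q0. q0 \<in> space X \<Longrightarrow> (\<Sum>j\<le>p. \<integral>\<^sup>+v. ennreal (\<alpha> j (q0, v)) \<partial>V q0) = 1) \<Longrightarrow>
        multiproposal_kernel X p \<alpha> S V \<in> X \<rightarrow>\<^sub>M prob_algebra X"
proof -
  let ?P = "multiproposal_kernel X p \<alpha> S V"
  let ?I = "\<lambda>j q0 A. \<integral>\<^sup>+v. ennreal (\<alpha> j (q0, v)) * indicator A (fst (S j (q0, v))) \<partial>V q0"
  have fstS: "(\<lambda>z. fst (S j z)) \<in> X \<Otimes>\<^sub>M power_space X p \<rightarrow>\<^sub>M X"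
    and \<alpha>': "\<alpha> j \<in> borel_measurable (X \<Otimes>\<^sub>M power_space X p)" if "j \<le> p" for j
    using S[OF that] \<alpha>[OF that] by (auto simp: full_space_def)
  show em: "emeasure (?P q0) A = (\<Sum>j\<le>p. ?I j q0 A)"
    if q0[measurable]: "q0 \<in> space X" and A: "A \<in> sets X" for q0 A
  proof -
    have V0[measurable_cong]: "sets (V q0) = sets (power_space X p)"
      using V q0 by (auto simp: markov_kernel_iff)
    define D where "D j = distr (density (V q0) (\<lambda>v. ennreal (\<alpha> j (q0, v)))) X (\<lambda>v. fst (S j (q0, v)))" for j
    have D: "emeasure (D j) B = ?I j q0 B" if j: "j \<le> p" and B[measurable]: "B \<in> sets X" for j B
    proof -
      note [measurable] = fstS[OF j] \<alpha>'[OF j]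
      have "emeasure (D j) B = (\<integral>\<^sup>+x. indicator B x \<partial>D j)"
        by (simp add: D_def)
      also have "\<dots> = (\<integral>\<^sup>+v. indicator B (fst (S j (q0, v))) \<partial>density (V q0) (\<lambda>v. ennreal (\<alpha> j (q0, v))))"
        unfolding D_def by (intro nn_integral_distr) measurable
      also have "\<dots> = ?I j q0 B"
        by (intro nn_integral_density) measurable
      finally show ?thesis .
    qed
    \<comment> \<open>The set functions are compared on measurable sets, where the point mass is an
      indicator.\<close>
    have "?P q0 = sum_measure X {..p} D"
      unfolding multiproposal_kernel_def sum_measure_def
      by (intro measure_of_eq sets.space_closed sum.cong refl)
         (simp add: D sets.sigma_sets_eq)
    then have "emeasure (?P q0) A = (\<Sum>j\<le>p. emeasure (D j) A)"
      using A by (simp add: emeasure_sum_measure D_def)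
    then show ?thesis using A by (simp add: D)
  qed
  assume total: "\<And>q0. q0 \<in> space X \<Longrightarrow> (\<Sum>j\<le>p. \<integral>\<^sup>+v. ennreal (\<alpha> j (q0, v)) \<partial>V q0) = 1"
  show "?P \<in> X \<rightarrow>\<^sub>M prob_algebra X"
    unfolding markov_kernel_iff
  proof (intro conjI ballI)
    fix q0 assume q0: "q0 \<in> space X"
    have V0: "sets (V q0) = sets (power_space X p)"
      using V q0 by (auto simp: markov_kernel_iff)
    \<comment> \<open>Every new state lies in \<open>space X\<close>, so the total mass is exactly
      the sum normalised to 1.\<close>
    have "fst (S j (q0, v)) \<in> space X" if "j \<le> p" "v \<in> space (V q0)" for j v
      using measurable_space[OF fstS[OF that(1)], of "(q0, v)"] that(2) q0 sets_eq_imp_space_eq[OF V0]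
      by (simp add: space_pair_measure)
    then have "emeasure (?P q0) (space X) = 1"
      unfolding total[OF q0, symmetric] em[OF q0 sets.top]
      by (intro sum.cong refl nn_integral_cong) auto
    then show "prob_space (?P q0)"
      using sets_eq_imp_space_eq[OF sets_multiproposal_kernel, of X p \<alpha> S V q0] by (intro prob_spaceI) simp
  next
    fix E assume E[measurable]: "E \<in> sets X"
    have "(\<lambda>q0. ?I j q0 E) \<in> borel_measurable X" if j: "j \<le> p" for j
    proof -
      note [measurable] = fstS[OF j] \<alpha>'[OF j]
      show ?thesis
        by (rule nn_integral_measurable_subprob_algebra2[OF _ measurable_prob_algebraD[OF V]]) measurable
    qed
    then have "(\<lambda>q0. \<Sum>j\<le>p. ?I j q0 E) \<in> borel_measurable X"
      by (intro borel_measurable_sum) auto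
    then show "(\<lambda>q0. emeasure (?P q0) E) \<in> borel_measurable X"
      using E by (simp add: em cong: measurable_cong)
  qed (simp add: sets_multiproposal_kernel)
qed

section \<open>Invariance of the summed pushforwards and detailed balance\<close>

theorem theorem2p10:
  fixes X \<mu> :: "'a measure"
    and Q Qbar :: "'a \<Rightarrow> 'a measure"
    and p :: nat
  defines "V \<equiv> proposal_kernel Q Qbar p"
  defines "M \<equiv> joint_measure X (power_space X p) \<mu> V"
  defines "push \<equiv> (\<lambda>f. distr M (full_space X p) f)"
  assumes p: "p \<ge> 1"
    and \<mu>: "prob_space \<mu>" "sets \<mu> = sets X"
    and Q: "Q \<in> X \<rightarrow>\<^sub>M prob_algebra X"
    and Qbar: "Qbar \<in> X \<rightarrow>\<^sub>M prob_algebra X"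
  shows "V \<in> X \<rightarrow>\<^sub>M prob_algebra (power_space X p)
    \<and> prob_space M \<and> sets M = sets (full_space X p)
    \<and> (\<forall>j\<le>p. \<forall>E\<in>sets (full_space X p).
        (\<Sum>k\<le>p. emeasure (push (swap_coord j \<circ> swap_coord k)) E) =
        (\<Sum>k\<le>p. emeasure (push (swap_coord k)) E))
    \<and> (\<forall>\<alpha> :: nat \<Rightarrow> 'a \<times> (nat \<Rightarrow> 'a) \<Rightarrow> real.
        (\<forall>j\<le>p. \<alpha> j \<in> borel_measurable (full_space X p)) \<longrightarrow>
        (\<forall>j\<le>p. \<forall>z\<in>space (full_space X p). 0 \<le> \<alpha> j z \<and> \<alpha> j z \<le> 1) \<longrightarrow>
        (\<forall>q0\<in>space X. (\<Sum>j\<le>p. \<integral>\<^sup>+v. ennreal (\<alpha> j (q0, v)) \<partial>V q0) = 1) \<longrightarrow>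
        (\<forall>j\<le>p. AE z in sum_measure (full_space X p) {..p} (\<lambda>k. push (swap_coord k)).
            ennreal (\<alpha> j z) =
            RN_deriv (sum_measure (full_space X p) {..p} (\<lambda>k. push (swap_coord k)))
              (push (swap_coord j)) z) \<longrightarrow>
        multiproposal_kernel X p \<alpha> swap_coord V \<in> X \<rightarrow>\<^sub>M prob_algebra X
        \<and> detailed_balance X \<mu> (multiproposal_kernel X p \<alpha> swap_coord V))"
proof -
  let ?F = "full_space X p"
  define N where "N = sum_measure ?F {..p} (\<lambda>k. push (swap_coord k))"
  have V: "V \<in> X \<rightarrow>\<^sub>M prob_algebra (power_space X p)"
    unfolding V_def using Q Qbar by (rule measurable_proposal_kernel)
  have M: "prob_space M" and sets_M: "sets M = sets ?F"
    using joint_measure_in_prob_algebra[OF \<mu> V] by (auto simp: M_def space_prob_algebra full_space_def)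
  have S: "swap_coord j \<in> ?F \<rightarrow>\<^sub>M ?F" if "j \<le> p" for j
    using that by (rule measurable_swap_coord)
  have S_M: "swap_coord j \<in> M \<rightarrow>\<^sub>M ?F" if "j \<le> p" for j
    using S[OF that] by (simp add: measurable_cong_sets[OF sets_M refl])
  have sum_push: "(\<Sum>k\<le>p. emeasure (push (swap_coord j \<circ> swap_coord k)) E) =
      (\<Sum>k\<le>p. emeasure (push (swap_coord k)) E)" if "j \<le> p" for j E
    unfolding push_def M_def V_def using \<mu> Q Qbar that by (rule sum_pushforward_swap_coord)
  have sets_N: "sets N = sets ?F" by (simp add: N_def)
  have N: "emeasure N E = (\<Sum>k\<le>p. emeasure (push (swap_coord k)) E)" if "E \<in> sets ?F" for E
    unfolding N_def by (rule emeasure_sum_measure[OF _ that]) (simp add: push_def)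
  \<comment> \<open>Pushing \<open>N\<close> forward by \<open>swap_coord j\<close> composes it with
    each swap in the sum, so the first identity of the theorem becomes invariance of
    \<open>N\<close>.\<close>
  have N_inv: "distr N N (swap_coord j) = N" if j: "j \<le> p" for j
  proof (rule measure_eqI)
    fix E assume "E \<in> sets (distr N N (swap_coord j))"
    then have E: "E \<in> sets ?F" by (simp add: sets_N)
    have SE: "swap_coord j -` E \<inter> space ?F \<in> sets ?F"
      using S[OF j] E by (rule measurable_sets)
    have "emeasure (distr N N (swap_coord j)) E = emeasure N (swap_coord j -` E \<inter> space ?F)"
      using S[OF j] E sets_eq_imp_space_eq[OF sets_N]
      by (subst emeasure_distr) (simp_all add: sets_N measurable_cong_sets[OF sets_N sets_N])
    also have "\<dots> = (\<Sum>k\<le>p. emeasure (push (swap_coord j \<circ> swap_coord k)) E)"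
      unfolding N[OF SE]
    proof (intro sum.cong refl)
      fix k assume "k \<in> {..p}"
      then have k: "k \<le> p" by simp
      have "push (swap_coord j \<circ> swap_coord k) = distr (push (swap_coord k)) ?F (swap_coord j)"
        unfolding push_def using S[OF j] S_M[OF k] by (rule distr_distr[symmetric])
      then show "emeasure (push (swap_coord k)) (swap_coord j -` E \<inter> space ?F) =
          emeasure (push (swap_coord j \<circ> swap_coord k)) E"
        using S[OF j] E by (simp add: emeasure_distr push_def)
    qed
    also have "\<dots> = emeasure N E"
      by (simp only: N[OF E] sum_push[OF j])
    finally show "emeasure (distr N N (swap_coord j)) E = emeasure N E" .
  qed simp
  have prob_push: "prob_space (push (swap_coord k))" if "k \<le> p" for k
    unfolding push_def using M S_M[OF that] by (rule prob_space.prob_space_distr)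
  \<comment> \<open>\<open>N\<close> is a sum of \<open>p + 1\<close> probability measures; its
    finiteness gives access to the Radon-Nikodym theorem.\<close>
  interpret N: finite_measure N
  proof
    have "emeasure (push (swap_coord k)) (space N) \<noteq> \<infinity>" if "k \<le> p" for k
      using finite_measure.emeasure_finite[OF prob_space.finite_measure[OF prob_push[OF that]]] by simp
    then show "emeasure N (space N) \<noteq> \<infinity>"
      using N[of "space N"] sets_N sets_eq_imp_space_eq[OF sets_N] by simp
  qed
  have push_RN: "density N (RN_deriv N (push (swap_coord k))) = push (swap_coord k)" if k: "k \<le> p" for k
  proof (rule N.density_RN_deriv)
    show sets: "sets (push (swap_coord k)) = sets N"
      by (simp add: push_def sets_N)
    \<comment> \<open>A vanishing sum of nonnegative terms has vanishing terms, so each summand of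
      \<open>N\<close> is dominated by \<open>N\<close>.\<close>
    show "absolutely_continuous N (push (swap_coord k))"
    unfolding absolutely_continuous_def
    proof
      fix E assume "E \<in> null_sets N"
      then have "E \<in> sets N" "(\<Sum>k\<le>p. emeasure (push (swap_coord k)) E) = 0"
        using N[of E] unfolding null_sets_def sets_N by simp_all
      then show "E \<in> null_sets (push (swap_coord k))"
        using k sets by (auto simp: null_sets_def)
    qed
  qed
  \<comment> \<open>This identifies \<alpha> with index 0 as the density of \<open>M\<close>
    itself.\<close>
  have push_0: "push (swap_coord 0) = M"
    unfolding push_def using distr_id2[OF sets_M[symmetric]] by (simp add: swap_coord_0[abs_def])
  show ?thesis
  proof (intro conjI allI impI)
    fix \<alpha> :: "nat \<Rightarrow> 'a \<times> (nat \<Rightarrow> 'a) \<Rightarrow> real"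
    assume "\<forall>j\<le>p. \<alpha> j \<in> borel_measurable ?F"
      and total: "\<forall>q0\<in>space X. (\<Sum>j\<le>p. \<integral>\<^sup>+v. ennreal (\<alpha> j (q0, v)) \<partial>V q0) = 1"
      and AE: "\<forall>j\<le>p. AE z in sum_measure ?F {..p} (\<lambda>k. push (swap_coord k)).
        ennreal (\<alpha> j z) = RN_deriv (sum_measure ?F {..p} (\<lambda>k. push (swap_coord k))) (push (swap_coord j)) z"
    then have \<alpha>: "\<alpha> j \<in> borel_measurable ?F" if "j \<le> p" for j
      using that by simp
    let ?P = "multiproposal_kernel X p \<alpha> swap_coord V"
    show P: "?P \<in> X \<rightarrow>\<^sub>M prob_algebra X"
      using total by (intro measurable_multiproposal_kernel V \<alpha> S) auto
    \<comment> \<open>Agreement with the derivative almost everywhere for \<open>N\<close> suffices,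
      since densities that agree almost everywhere define the same measure.\<close>
    have density_\<alpha>: "density N (\<lambda>z. ennreal (\<alpha> j z)) = push (swap_coord j)" if j: "j \<le> p" for j
    proof -
      have "density N (\<lambda>z. ennreal (\<alpha> j z)) = density N (RN_deriv N (push (swap_coord j)))"
        using AE[folded N_def] \<alpha>[OF j] j
        by (intro density_cong borel_measurable_RN_deriv) (auto simp: measurable_cong_sets[OF sets_N refl])
      then show ?thesis by (simp only: push_RN[OF j])
    qed
    have swap: "(\<integral>\<^sup>+z. ennreal (\<alpha> j z) * g z \<partial>M) = (\<integral>\<^sup>+z. ennreal (\<alpha> j z) * g (swap_coord j z) \<partial>M)"
      if j: "j \<le> p" and g: "g \<in> borel_measurable ?F" for j g
    proof (rule nn_integral_density_involution[where N = N and a = "\<lambda>z. ennreal (\<alpha> 0 z)"])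
      show "density N (\<lambda>z. ennreal (\<alpha> j z)) = distr M N (swap_coord j)"
        using density_\<alpha>[OF j] by (simp add: push_def sets_N cong: distr_cong)
    qed (use \<alpha>[OF j] \<alpha>[of 0] g S[OF j] N_inv[OF j] density_\<alpha>[of 0] push_0 in
        \<open>simp_all add: swap_coord_involution measurable_cong_sets[OF sets_N refl]
          measurable_cong_sets[OF refl sets_N]\<close>)
    show "detailed_balance X \<mu> ?P"
      unfolding detailed_balance_def
    proof (rule measure_eqI)
      let ?L = "\<mu> \<bind> (\<lambda>q. ?P q \<bind> (\<lambda>q'. return (X \<Otimes>\<^sub>M X) (q, q')))"
      let ?R = "\<mu> \<bind> (\<lambda>q'. ?P q' \<bind> (\<lambda>q. return (X \<Otimes>\<^sub>M X) (q, q')))"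
      have sets: "sets ?L = sets (X \<Otimes>\<^sub>M X)" "sets ?R = sets (X \<Otimes>\<^sub>M X)"
        using bind_return_in_prob_algebra[OF \<mu> P, of Pair "X \<Otimes>\<^sub>M X"]
          bind_return_in_prob_algebra[OF \<mu> P, of "\<lambda>x y. (y, x)" "X \<Otimes>\<^sub>M X"]
        by (auto simp: space_prob_algebra)
      then show "sets ?L = sets ?R" by simp
      fix E assume "E \<in> sets ?L"
      then have E[measurable]: "E \<in> sets (X \<Otimes>\<^sub>M X)" using sets by simp
      \<comment> \<open>The joint law of current and next state is a sum over \<open>j\<close> of
        images of \<open>\<alpha> j dM\<close> under the map sending \<open>z\<close> to the first
        coordinates of \<open>z\<close> and of \<open>swap_coord j z\<close>.\<close>
      have integral_P: "(\<integral>\<^sup>+q0. \<integral>\<^sup>+q. indicator A (q0, q) \<partial>?P q0 \<partial>\<mu>) =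
          (\<Sum>j\<le>p. \<integral>\<^sup>+z. ennreal (\<alpha> j z) * indicator A (fst z, fst (swap_coord j z)) \<partial>M)"
        if A[measurable]: "A \<in> sets (X \<Otimes>\<^sub>M X)" for A
      proof -
        let ?h = "\<lambda>j z. ennreal (\<alpha> j z) * indicator A (fst z, fst (swap_coord j z))"
        have h: "?h j \<in> borel_measurable (X \<Otimes>\<^sub>M power_space X p)" if j: "j \<le> p" for j
        proof -
          note [measurable] = \<alpha>[OF j, unfolded full_space_def] S[OF j, unfolded full_space_def]
          show ?thesis by measurable
        qed
        have "(\<integral>\<^sup>+q. indicator A (q0, q) \<partial>?P q0) = (\<Sum>j\<le>p. \<integral>\<^sup>+v. ?h j (q0, v) \<partial>V q0)"
          if q0: "q0 \<in> space X" for q0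
        proof -
          have A0: "Pair q0 -` A \<in> sets X" using A by (rule sets_Pair1)
          have "(\<integral>\<^sup>+q. indicator A (q0, q) \<partial>?P q0) = (\<integral>\<^sup>+q. indicator (Pair q0 -` A) q \<partial>?P q0 :: ennreal)"
            by (simp add: indicator_def)
          also have "\<dots> = emeasure (?P q0) (Pair q0 -` A)"
            using A0 by (simp add: sets_multiproposal_kernel)
          also have "\<dots> = (\<Sum>j\<le>p. \<integral>\<^sup>+v. ?h j (q0, v) \<partial>V q0)"
            using emeasure_multiproposal_kernel[OF V \<alpha> S q0 A0] by (simp add: indicator_def)
          finally show ?thesis .
        qed
        then have "(\<integral>\<^sup>+q0. \<integral>\<^sup>+q. indicator A (q0, q) \<partial>?P q0 \<partial>\<mu>) =
            (\<integral>\<^sup>+q0. (\<Sum>j\<le>p. \<integral>\<^sup>+v. ?h j (q0, v) \<partial>V q0) \<partial>\<mu>)"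
          using sets_eq_imp_space_eq[OF \<mu>(2)] by (intro nn_integral_cong) simp
        also have "\<dots> = (\<Sum>j\<le>p. \<integral>\<^sup>+q0. \<integral>\<^sup>+v. ?h j (q0, v) \<partial>V q0 \<partial>\<mu>)"
        proof (rule nn_integral_sum)
          fix j assume "j \<in> {..p}"
          then have "(\<lambda>(q0, v). ?h j (q0, v)) \<in> borel_measurable (X \<Otimes>\<^sub>M power_space X p)"
            using h[of j] by (simp add: split_beta')
          then show "(\<lambda>q0. \<integral>\<^sup>+v. ?h j (q0, v) \<partial>V q0) \<in> borel_measurable \<mu>"
            unfolding measurable_cong_sets[OF \<mu>(2) refl]
            by (rule nn_integral_measurable_subprob_algebra2[OF _ measurable_prob_algebraD[OF V]])
        qed
        also have "\<dots> = (\<Sum>j\<le>p. \<integral>\<^sup>+z. ?h j z \<partial>M)"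
          unfolding M_def by (intro sum.cong refl nn_integral_joint_measure[OF \<mu> V, symmetric] h) auto
        finally show ?thesis .
      qed
      \<comment> \<open>The right side of detailed balance draws the second coordinate from
        \<open>\<mu>\<close>, so its value at \<open>E\<close> is the joint law evaluated at the
        transposed set \<open>?E'\<close>.\<close>
      let ?E' = "(\<lambda>(x, y). (y, x)) -` E \<inter> space (X \<Otimes>\<^sub>M X)"
      have E': "?E' \<in> sets (X \<Otimes>\<^sub>M X)" by measurable
      have "emeasure ?L E = (\<integral>\<^sup>+z. indicator E z \<partial>?L)"
        using sets by simp
      also have "\<dots> = (\<integral>\<^sup>+q0. \<integral>\<^sup>+q. indicator E (q0, q) \<partial>?P q0 \<partial>\<mu>)"
        by (intro nn_integral_bind_return[OF \<mu> P]) auto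
      also have "\<dots> = (\<Sum>j\<le>p. \<integral>\<^sup>+z. ennreal (\<alpha> j z) * indicator E (fst z, fst (swap_coord j z)) \<partial>M)"
        by (rule integral_P[OF E])
      also have "\<dots> = (\<Sum>j\<le>p. \<integral>\<^sup>+z. ennreal (\<alpha> j z) * indicator ?E' (fst z, fst (swap_coord j z)) \<partial>M)"
      proof (intro sum.cong refl)
        fix j assume "j \<in> {..p}"
        then have j: "j \<le> p" by simp
        note [measurable] = S[OF j, unfolded full_space_def]
        \<comment> \<open>Replacing \<open>z\<close> by \<open>swap_coord j z\<close> exchanges the
          two states, because the swap is an involution; this turns \<open>E\<close> into
          \<open>?E'\<close> separately for each \<open>j\<close>.\<close>
        have "(\<integral>\<^sup>+z. ennreal (\<alpha> j z) * indicator E (fst z, fst (swap_coord j z)) \<partial>M) =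
            (\<integral>\<^sup>+z. ennreal (\<alpha> j z) *
              indicator E (fst (swap_coord j z), fst (swap_coord j (swap_coord j z))) \<partial>M)"
          by (rule swap[OF j]) (unfold full_space_def, measurable)
        also have "\<dots> = (\<integral>\<^sup>+z. ennreal (\<alpha> j z) * indicator ?E' (fst z, fst (swap_coord j z)) \<partial>M)"
        proof (intro nn_integral_cong)
          fix z assume "z \<in> space M"
          then have "z \<in> space ?F" "swap_coord j z \<in> space ?F"
            using measurable_space[OF S[OF j]] sets_eq_imp_space_eq[OF sets_M] by auto
          then have "fst z \<in> space X" "fst (swap_coord j z) \<in> space X"
            by (auto simp: full_space_def space_pair_measure)
          then show "ennreal (\<alpha> j z) * indicator E (fst (swap_coord j z), fst (swap_coord j (swap_coord j z))) =
              ennreal (\<alpha> j z) * indicator ?E' (fst z, fst (swap_coord j z))"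
            by (simp add: swap_coord_involution indicator_def space_pair_measure)
        qed
        finally show "(\<integral>\<^sup>+z. ennreal (\<alpha> j z) * indicator E (fst z, fst (swap_coord j z)) \<partial>M) =
            (\<integral>\<^sup>+z. ennreal (\<alpha> j z) * indicator ?E' (fst z, fst (swap_coord j z)) \<partial>M)" .
      qed
      also have "\<dots> = (\<integral>\<^sup>+q0. \<integral>\<^sup>+q. indicator ?E' (q0, q) \<partial>?P q0 \<partial>\<mu>)"
        by (rule integral_P[OF E', symmetric])
      also have "\<dots> = (\<integral>\<^sup>+q0. \<integral>\<^sup>+q. indicator E (q, q0) \<partial>?P q0 \<partial>\<mu>)"
        using sets_eq_imp_space_eq[OF \<mu>(2)] sets_eq_imp_space_eq[OF sets_multiproposal_kernel, of X p \<alpha> swap_coord V]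
        by (intro nn_integral_cong) (simp add: indicator_def space_pair_measure)
      also have "\<dots> = (\<integral>\<^sup>+z. indicator E z \<partial>?R)"
        by (intro nn_integral_bind_return[OF \<mu> P, symmetric]) auto
      also have "\<dots> = emeasure ?R E"
        using sets by simp
      finally show "emeasure ?L E = emeasure ?R E" .
    qed
  qed (use V M sets_M sum_push in auto)
qed

end
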